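(* Assume (D) from the context. Assume that the value function $V$ is continuous and that, for every $x_1\ge0$, the map $x_2\mapsto H(x_1,x_2)$ is nonincreasing on $[0,\infty)$, where $H=V-G$. Define $$\mathfrak b(x_1):=\inf\{x_2\ge0:H(x_1,x_2)=0\}\in[0,\infty],\qquad \inf\varnothing:=+\infty.$$ Then $\mathfrak b:[0,\infty)\to[0,\infty]$ is lower semicontinuous and $$\mathcal D=\{(x_1,x_2)\in[0,\infty)^2:x_2\ge\mathfrak b(x_1)\},\qquad \mathcal C=\{(x_1,x_2)\in[0,\infty)^2:0\le x_2<\mathfrak b(x_1)\}.$$
   Context: **Reflected diffusion.** $W$ is a two-dimensional Brownian motion on a filtered probability space satisfying the usual conditions, with filtration $\mathbb F$. $X=(X^1,X^2)$ is a diffusion in $[0,\infty)^2$ solving $dX_t=\beta(X_t)dt+\sigma(X_t)dW_t+\rho_1dL_t^1+\rho_2dL_t^2$, $X_0=x$, where $\beta:[0,\infty)^2\to\mathbb R^2$, $\sigma:[0,\infty)^2\to\mathbb R^{2\times2}$, $a=\sigma\sigma^\top$, $\rho_1=(1,\theta_1)$, $\rho_2=(\theta_2,1)$ with $\theta_1,\theta_2\in\mathbb R$. Each $L^i$ is continuous, adapted, nondecreasing, $L^i_0=0$, and $\int_0^\infty \mathbf 1_{\{X^i_s>0\}}dL^i_s=0$. $\mathbb E_x$ is expectation for $X_0=x$. **(D)** $\beta,\sigma$ are continuous and locally Lipschitz on $[0,\infty)^2$ with $|\beta(x)|+\|\sigma(x)\|\le K(1+|x|)$; $a$ is locally uniformly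 elliptic in $(0,\infty)^2$; $1-\theta_1\theta_2>0$ and the associated orthant Skorokhod problem is well posed; for every $x\in[0,\infty)^2$ the reflected SDE has a unique strong solution in $[0,\infty)^2$ and its transition semigroup is Feller; $L^1,L^2$ do not charge the corner $\{0\}$. **Stopping problem.** Fix $r>0$, $\alpha>0$, a continuous $c:[0,\infty)^2\to[0,\infty)$, and $G(x)=x_1\vee\alpha x_2$. $V(x)=\sup_\tau\mathbb E_x[e^{-r\tau}G(X_\tau)-\int_0^\tau e^{-rs}c(X_s)ds]$ over all $\mathbb F$-stopping times (so $V\ge G$); $H=V-G$, $\mathcal C=\{H>0\}$, $\mathcal D=\{H=0\}$. *)

theory Defs
  imports "HOL-Probability.Probability"
begin

section \<open>Filtered probability space and Brownian motion\<close>

text \<open>Processes are indexed by real times, of which only those in \<open>{0..}\<close> matter. Filtrations are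
  indexed by \<^typ>\<open>ennreal\<close>, so that the library's \<^const>\<open>stopping_time\<close> is a
  \<open>[0,\<infinity>]\<close>-valued stopping time: its condition at \<open>t = \<infinity>\<close> is void,
  and the choice of \<open>F \<infinity>\<close> is immaterial.\<close>

definition usual_conditions :: "'a measure \<Rightarrow> (ennreal \<Rightarrow> 'a measure) \<Rightarrow> bool" where
  "usual_conditions M F \<longleftrightarrow>
     prob_space M \<and> complete_measure M \<and>
     filtration (space M) F \<and> (\<forall>t. subalgebra M (F t)) \<and>
     null_sets M \<subseteq> sets (F 0) \<and>
     (\<forall>t<\<infinity>. sets (F t) = (\<Inter>s\<in>{t<..}. sets (F s)))"

definition adapted ::
  "(ennreal \<Rightarrow> 'a measure) \<Rightarrow> (real \<Rightarrow> 'a \<Rightarrow> 'b::topological_space) \<Rightarrow> bool" where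
  "adapted F Y \<longleftrightarrow> (\<forall>t\<ge>0. Y t \<in> borel_measurable (F (ennreal t)))"

definition progressive ::
  "(ennreal \<Rightarrow> 'a measure) \<Rightarrow> (real \<Rightarrow> 'a \<Rightarrow> 'b::topological_space) \<Rightarrow> bool" where
  "progressive F Y \<longleftrightarrow>
     (\<forall>T\<ge>0. (\<lambda>(t, \<omega>). Y t \<omega>) \<in>
        borel_measurable (restrict_space borel {0..T} \<Otimes>\<^sub>M F (ennreal T)))"

definition brownian_motion ::
  "'a measure \<Rightarrow> (ennreal \<Rightarrow> 'a measure) \<Rightarrow> (real \<Rightarrow> 'a \<Rightarrow> real^2) \<Rightarrow> bool" where
  "brownian_motion M F W \<longleftrightarrow>
     adapted F W \<and>
     (AE \<omega> in M. W 0 \<omega> = 0) \<and>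
     (\<forall>\<omega>\<in>space M. continuous_on {0..} (\<lambda>t. W t \<omega>)) \<and>
     (\<forall>s t. 0 \<le> s \<and> s < t \<longrightarrow>
        distributed M lborel (\<lambda>\<omega>. W t \<omega> - W s \<omega>)
          (\<lambda>y. ennreal (\<Prod>i\<in>UNIV. normal_density 0 (sqrt (t - s)) (y $ i))) \<and>
        prob_space.indep_set M (sets (F (ennreal s)))
          {(\<lambda>\<omega>. W t \<omega> - W s \<omega>) -` B \<inter> space M | B. B \<in> sets borel})"

definition augmented_brownian_filtration ::
  "'a measure \<Rightarrow> (real \<Rightarrow> 'a \<Rightarrow> real^2) \<Rightarrow> ennreal \<Rightarrow> 'a measure" where
  "augmented_brownian_filtration M W t =
     sigma (space M)
       ({W s -` B \<inter> space M | s B. 0 \<le> s \<and> ennreal s \<le> t \<and> B \<in> sets borel} \<union> null_sets M)"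


section \<open>The Ito integral\<close>

text \<open>\<open>simple_integrand M F n t \<xi>\<close>: the process
  \<open>\<Sum>i<n. 1\<^bsub>(t i, t (i+1)]\<^esub> \<xi> i\<close> with bounded, \<open>F (t i)\<close>-measurable \<open>\<xi> i\<close>.\<close>

definition simple_integrand ::
  "'a measure \<Rightarrow> (ennreal \<Rightarrow> 'a measure) \<Rightarrow> nat \<Rightarrow> (nat \<Rightarrow> real) \<Rightarrow> (nat \<Rightarrow> 'a \<Rightarrow> real^2^2) \<Rightarrow> bool" where
  "simple_integrand M F n t \<xi> \<longleftrightarrow>
     0 \<le> t 0 \<and> (\<forall>i<n. t i \<le> t (Suc i)) \<and>
     (\<forall>i<n. \<xi> i \<in> borel_measurable (F (ennreal (t i))) \<and>
        (\<exists>B. \<forall>\<omega>\<in>space M. norm (\<xi> i \<omega>) \<le> B))"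

definition simple_value ::
  "nat \<Rightarrow> (nat \<Rightarrow> real) \<Rightarrow> (nat \<Rightarrow> 'a \<Rightarrow> real^2^2) \<Rightarrow> real \<Rightarrow> 'a \<Rightarrow> real^2^2" where
  "simple_value n t \<xi> s \<omega> = (\<Sum>i<n. indicator {t i<..t (Suc i)} s *\<^sub>R \<xi> i \<omega>)"

definition simple_integral ::
  "(real \<Rightarrow> 'a \<Rightarrow> real^2) \<Rightarrow> nat \<Rightarrow> (nat \<Rightarrow> real) \<Rightarrow> (nat \<Rightarrow> 'a \<Rightarrow> real^2^2) \<Rightarrow> real \<Rightarrow> 'a \<Rightarrow> real^2" where
  "simple_integral W n t \<xi> s \<omega> =
     (\<Sum>i<n. \<xi> i \<omega> *v (W (min s (t (Suc i))) \<omega> - W (min s (t i)) \<omega>))"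

definition null_in_probability :: "'a measure \<Rightarrow> (nat \<Rightarrow> 'a \<Rightarrow> ennreal) \<Rightarrow> bool" where
  "null_in_probability M Y \<longleftrightarrow>
     (\<forall>\<epsilon>>0. (\<lambda>n. emeasure M {\<omega>\<in>space M. ennreal \<epsilon> < Y n \<omega>}) \<longlonglongrightarrow> 0)"

text \<open>\<open>is_ito_integral M F W Y I\<close>: the process \<open>I\<close> is (a version of) \<open>\<integral>\<^sub>0 Y dW\<close>, for
  progressive \<open>Y\<close> with \<open>\<integral>\<^sub>0\<^sup>T |Y|\<^sup>2 ds < \<infinity>\<close> a.s. It is the continuous process obtained as
  the limit in probability of integrals of simple processes approximating \<open>Y\<close>; this determines \<open>I\<close> up to
  indistinguishability. The norm on \<^typ>\<open>real^2^2\<close> is the Frobenius norm.\<close>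

definition is_ito_integral ::
  "'a measure \<Rightarrow> (ennreal \<Rightarrow> 'a measure) \<Rightarrow> (real \<Rightarrow> 'a \<Rightarrow> real^2) \<Rightarrow>
   (real \<Rightarrow> 'a \<Rightarrow> real^2^2) \<Rightarrow> (real \<Rightarrow> 'a \<Rightarrow> real^2) \<Rightarrow> bool" where
  "is_ito_integral M F W Y I \<longleftrightarrow>
     progressive F Y \<and>
     (AE \<omega> in M. \<forall>T\<ge>0. (\<integral>\<^sup>+ s\<in>{0..T}. ennreal ((norm (Y s \<omega>))\<^sup>2) \<partial>lborel) < \<infinity>) \<and>
     adapted F I \<and> (\<forall>\<omega>\<in>space M. continuous_on {0..} (\<lambda>t. I t \<omega>)) \<and>
     (\<exists>n t \<xi>.
        (\<forall>k. simple_integrand M F (n k) (t k) (\<xi> k)) \<and>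
        (\<forall>T\<ge>0.
           null_in_probability M (\<lambda>k \<omega>. \<integral>\<^sup>+ s\<in>{0..T}.
             ennreal ((norm (simple_value (n k) (t k) (\<xi> k) s \<omega> - Y s \<omega>))\<^sup>2) \<partial>lborel) \<and>
           null_in_probability M (\<lambda>k \<omega>.
             ennreal (norm (simple_integral W (n k) (t k) (\<xi> k) T \<omega> - I T \<omega>)))))"


section \<open>Reflection in the quadrant\<close>

definition quadrant :: "(real^2) set" where
  "quadrant = {x. 0 \<le> x $ 1 \<and> 0 \<le> x $ 2}"

definition open_quadrant :: "(real^2) set" where
  "open_quadrant = {x. 0 < x $ 1 \<and> 0 < x $ 2}"

text \<open>\<open>\<integral>\<^sub>0\<^sup>\<infinity> 1\<^bsub>A\<^esub>(s) dl(s)\<close> for a continuous nondecreasing \<open>l\<close> on \<open>{0..}\<close>.\<close>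

definition stieltjes_mass :: "(real \<Rightarrow> real) \<Rightarrow> real set \<Rightarrow> ennreal" where
  "stieltjes_mass l A =
     (\<integral>\<^sup>+ s. indicator (A \<inter> {0..}) s \<partial>interval_measure (\<lambda>t. l (max 0 t)))"

definition regulator :: "(real \<Rightarrow> real^2) \<Rightarrow> (real \<Rightarrow> real^2) \<Rightarrow> bool" where
  "regulator \<phi> l \<longleftrightarrow>
     l 0 = 0 \<and> continuous_on {0..} l \<and>
     (\<forall>i. mono_on {0..} (\<lambda>t. l t $ i) \<and>
          stieltjes_mass (\<lambda>t. l t $ i) {s. \<phi> s $ i > 0} = 0)"

definition reflection :: "real \<Rightarrow> real \<Rightarrow> real^2 \<Rightarrow> real^2" where
  "reflection \<theta>\<^sub>1 \<theta>\<^sub>2 l = l $ 1 *\<^sub>R vector [1, \<theta>\<^sub>1] + l $ 2 *\<^sub>R vector [\<theta>\<^sub>2, 1]"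

definition skorokhod_solution ::
  "real \<Rightarrow> real \<Rightarrow> (real \<Rightarrow> real^2) \<Rightarrow> (real \<Rightarrow> real^2) \<Rightarrow> (real \<Rightarrow> real^2) \<Rightarrow> bool" where
  "skorokhod_solution \<theta>\<^sub>1 \<theta>\<^sub>2 \<psi> \<phi> l \<longleftrightarrow>
     continuous_on {0..} \<phi> \<and> \<phi> ` {0..} \<subseteq> quadrant \<and> regulator \<phi> l \<and>
     (\<forall>t\<ge>0. \<phi> t = \<psi> t + reflection \<theta>\<^sub>1 \<theta>\<^sub>2 (l t))"

definition skorokhod_well_posed :: "real \<Rightarrow> real \<Rightarrow> bool" where
  "skorokhod_well_posed \<theta>\<^sub>1 \<theta>\<^sub>2 \<longleftrightarrow>
     (\<forall>\<psi>. continuous_on {0..} \<psi> \<and> \<psi> 0 \<in> quadrant \<longrightarrow>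
        (\<exists>\<phi> l. skorokhod_solution \<theta>\<^sub>1 \<theta>\<^sub>2 \<psi> \<phi> l \<and>
           (\<forall>\<phi>' l'. skorokhod_solution \<theta>\<^sub>1 \<theta>\<^sub>2 \<psi> \<phi>' l' \<longrightarrow>
              (\<forall>t\<ge>0. \<phi>' t = \<phi> t \<and> l' t = l t))))"


section \<open>The reflected diffusion\<close>

text \<open>The path properties are required for every \<open>\<omega>\<close> and the stochastic equation almost surely. Under the
  usual conditions a solution whose path properties hold only almost surely can be
  modified on a null set so that they hold everywhere.\<close>

definition reflected_sde_solution ::
  "'a measure \<Rightarrow> (ennreal \<Rightarrow> 'a measure) \<Rightarrow> (real \<Rightarrow> 'a \<Rightarrow> real^2) \<Rightarrow>
   (real^2 \<Rightarrow> real^2) \<Rightarrow> (real^2 \<Rightarrow> real^2^2) \<Rightarrow> real \<Rightarrow> real \<Rightarrow> real^2 \<Rightarrow>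
   (real \<Rightarrow> 'a \<Rightarrow> real^2) \<Rightarrow> (real \<Rightarrow> 'a \<Rightarrow> real^2) \<Rightarrow> bool" where
  "reflected_sde_solution M F W \<beta> \<sigma> \<theta>\<^sub>1 \<theta>\<^sub>2 x X L \<longleftrightarrow>
     adapted F X \<and> adapted F L \<and>
     (\<forall>\<omega>\<in>space M.
        X 0 \<omega> = x \<and> continuous_on {0..} (\<lambda>t. X t \<omega>) \<and> (\<forall>t\<ge>0. X t \<omega> \<in> quadrant) \<and>
        regulator (\<lambda>t. X t \<omega>) (\<lambda>t. L t \<omega>)) \<and>
     (\<exists>I. is_ito_integral M F W (\<lambda>s \<omega>. \<sigma> (X s \<omega>)) I \<and>
        (AE \<omega> in M. \<forall>t\<ge>0.
           X t \<omega> = x + (LINT s:{0..t}|lborel. \<beta> (X s \<omega>)) + I t \<omega> + reflection \<theta>\<^sub>1 \<theta>\<^sub>2 (L t \<omega>)))"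

definition unique_strong_solution ::
  "'a measure \<Rightarrow> (ennreal \<Rightarrow> 'a measure) \<Rightarrow> (real \<Rightarrow> 'a \<Rightarrow> real^2) \<Rightarrow>
   (real^2 \<Rightarrow> real^2) \<Rightarrow> (real^2 \<Rightarrow> real^2^2) \<Rightarrow> real \<Rightarrow> real \<Rightarrow> real^2 \<Rightarrow>
   (real \<Rightarrow> 'a \<Rightarrow> real^2) \<Rightarrow> (real \<Rightarrow> 'a \<Rightarrow> real^2) \<Rightarrow> bool" where
  "unique_strong_solution M F W \<beta> \<sigma> \<theta>\<^sub>1 \<theta>\<^sub>2 x X L \<longleftrightarrow>
     reflected_sde_solution M F W \<beta> \<sigma> \<theta>\<^sub>1 \<theta>\<^sub>2 x X L \<and>
     adapted (augmented_brownian_filtration M W) X \<and>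
     adapted (augmented_brownian_filtration M W) L \<and>
     (\<forall>X' L'. reflected_sde_solution M F W \<beta> \<sigma> \<theta>\<^sub>1 \<theta>\<^sub>2 x X' L' \<longrightarrow>
        (AE \<omega> in M. \<forall>t\<ge>0. X' t \<omega> = X t \<omega> \<and> L' t \<omega> = L t \<omega>))"

definition C0_on :: "'b::real_normed_vector set \<Rightarrow> ('b \<Rightarrow> real) \<Rightarrow> bool" where
  "C0_on S f \<longleftrightarrow> continuous_on S f \<and> (f \<longlongrightarrow> 0) (inf at_infinity (principal S))"

text \<open>\<open>X x\<close> is the process started at \<open>x\<close>.\<close>

definition transition ::
  "'a measure \<Rightarrow> (real^2 \<Rightarrow> real \<Rightarrow> 'a \<Rightarrow> real^2) \<Rightarrow> real \<Rightarrow> (real^2 \<Rightarrow> real) \<Rightarrow> real^2 \<Rightarrow> real" where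
  "transition M X t f x = (LINT \<omega>|M. f (X x t \<omega>))"

definition feller_semigroup ::
  "'b::real_normed_vector set \<Rightarrow> (real \<Rightarrow> ('b \<Rightarrow> real) \<Rightarrow> 'b \<Rightarrow> real) \<Rightarrow> bool" where
  "feller_semigroup S P \<longleftrightarrow>
     (\<forall>f. C0_on S f \<longrightarrow>
        (\<forall>t\<ge>0. C0_on S (P t f)) \<and>
        (\<forall>s\<ge>0. \<forall>t\<ge>0. \<forall>x\<in>S. P (s + t) f x = P s (P t f) x) \<and>
        uniform_limit S (\<lambda>t. P t f) f (at_right 0))"

definition locally_uniformly_elliptic_on :: "(real^2) set \<Rightarrow> (real^2 \<Rightarrow> real^2^2) \<Rightarrow> bool" where
  "locally_uniformly_elliptic_on S a \<longleftrightarrow>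
     (\<forall>C. compact C \<and> C \<subseteq> S \<longrightarrow>
        (\<exists>\<kappa>>0. \<forall>x\<in>C. \<forall>\<xi>. \<kappa> * (norm \<xi>)\<^sup>2 \<le> \<xi> \<bullet> (a x *v \<xi>)))"

definition condition_D ::
  "'a measure \<Rightarrow> (ennreal \<Rightarrow> 'a measure) \<Rightarrow> (real \<Rightarrow> 'a \<Rightarrow> real^2) \<Rightarrow>
   (real^2 \<Rightarrow> real^2) \<Rightarrow> (real^2 \<Rightarrow> real^2^2) \<Rightarrow> real \<Rightarrow> real \<Rightarrow>
   (real^2 \<Rightarrow> real \<Rightarrow> 'a \<Rightarrow> real^2) \<Rightarrow> (real^2 \<Rightarrow> real \<Rightarrow> 'a \<Rightarrow> real^2) \<Rightarrow> bool" where
  "condition_D M F W \<beta> \<sigma> \<theta>\<^sub>1 \<theta>\<^sub>2 X L \<longleftrightarrow>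
     continuous_on quadrant \<beta> \<and> continuous_on quadrant \<sigma> \<and>
     local_lipschitz (UNIV :: real set) quadrant (\<lambda>_. \<beta>) \<and>
     local_lipschitz (UNIV :: real set) quadrant (\<lambda>_. \<sigma>) \<and>
     (\<exists>K. \<forall>x\<in>quadrant. norm (\<beta> x) + norm (\<sigma> x) \<le> K * (1 + norm x)) \<and>
     locally_uniformly_elliptic_on open_quadrant (\<lambda>x. \<sigma> x ** transpose (\<sigma> x)) \<and>
     1 - \<theta>\<^sub>1 * \<theta>\<^sub>2 > 0 \<and>
     skorokhod_well_posed \<theta>\<^sub>1 \<theta>\<^sub>2 \<and>
     (\<forall>x\<in>quadrant. unique_strong_solution M F W \<beta> \<sigma> \<theta>\<^sub>1 \<theta>\<^sub>2 x (X x) (L x)) \<and>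
     feller_semigroup quadrant (transition M X) \<and>
     (\<forall>x\<in>quadrant. \<forall>i. AE \<omega> in M.
        stieltjes_mass (\<lambda>t. L x t \<omega> $ i) {s. X x s \<omega> = 0} = 0)"


section \<open>The stopping problem\<close>

definition gain :: "real \<Rightarrow> real^2 \<Rightarrow> real" where
  "gain \<alpha> x = max (x $ 1) (\<alpha> * x $ 2)"

text \<open>\<open>e\<^sup>-\<^sup>r\<^sup>\<tau> G(X\<^sub>\<tau>) - \<integral>\<^sub>0\<^sup>\<tau> e\<^sup>-\<^sup>r\<^sup>s c(X\<^sub>s) ds\<close>, the first term being \<open>0\<close> on \<open>{\<tau> = \<infinity>}\<close>.\<close>

definition payoff ::
  "real \<Rightarrow> real \<Rightarrow> (real^2 \<Rightarrow> real) \<Rightarrow> (real \<Rightarrow> 'a \<Rightarrow> real^2) \<Rightarrow> ('a \<Rightarrow> ennreal) \<Rightarrow> 'a \<Rightarrow> ereal" where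
  "payoff r \<alpha> c X \<tau> \<omega> =
     ereal (if \<tau> \<omega> = \<infinity> then 0
            else exp (- r * enn2real (\<tau> \<omega>)) * gain \<alpha> (X (enn2real (\<tau> \<omega>)) \<omega>))
     - enn2ereal (\<integral>\<^sup>+ s\<in>{s. 0 \<le> s \<and> ennreal s \<le> \<tau> \<omega>}. ennreal (exp (- r * s) * c (X s \<omega>)) \<partial>lborel)"

text \<open>Expectation of an extended real random variable; meaningful only if the expectations of the
  positive and of the negative part are not both infinite (\<^const>\<open>e2ennreal\<close> takes the positive part).\<close>

definition has_expectation :: "'a measure \<Rightarrow> ('a \<Rightarrow> ereal) \<Rightarrow> bool" where
  "has_expectation M Z \<longleftrightarrow>
     (\<integral>\<^sup>+ \<omega>. e2ennreal (Z \<omega>) \<partial>M) < \<infinity> \<or> (\<integral>\<^sup>+ \<omega>. e2ennreal (- Z \<omega>) \<partial>M) < \<infinity>"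

definition ext_expectation :: "'a measure \<Rightarrow> ('a \<Rightarrow> ereal) \<Rightarrow> ereal" where
  "ext_expectation M Z =
     enn2ereal (\<integral>\<^sup>+ \<omega>. e2ennreal (Z \<omega>) \<partial>M) - enn2ereal (\<integral>\<^sup>+ \<omega>. e2ennreal (- Z \<omega>) \<partial>M)"

definition value_fun ::
  "'a measure \<Rightarrow> (ennreal \<Rightarrow> 'a measure) \<Rightarrow> real \<Rightarrow> real \<Rightarrow> (real^2 \<Rightarrow> real) \<Rightarrow>
   (real^2 \<Rightarrow> real \<Rightarrow> 'a \<Rightarrow> real^2) \<Rightarrow> real^2 \<Rightarrow> ereal" where
  "value_fun M F r \<alpha> c X x =
     (SUP \<tau> \<in> {\<tau>. stopping_time F \<tau> \<and> has_expectation M (payoff r \<alpha> c (X x) \<tau>)}.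
        ext_expectation M (payoff r \<alpha> c (X x) \<tau>))"

definition excess :: "real \<Rightarrow> (real^2 \<Rightarrow> ereal) \<Rightarrow> real^2 \<Rightarrow> ereal" where
  "excess \<alpha> V x = V x - ereal (gain \<alpha> x)"

definition continuation_region :: "(real^2 \<Rightarrow> ereal) \<Rightarrow> (real^2) set" where
  "continuation_region H = {x\<in>quadrant. H x > 0}"

definition stopping_region :: "(real^2 \<Rightarrow> ereal) \<Rightarrow> (real^2) set" where
  "stopping_region H = {x\<in>quadrant. H x = 0}"

definition boundary :: "(real^2 \<Rightarrow> ereal) \<Rightarrow> real \<Rightarrow> ennreal" where
  "boundary H x\<^sub>1 = Inf {ennreal x\<^sub>2 | x\<^sub>2. 0 \<le> x\<^sub>2 \<and> H (vector [x\<^sub>1, x\<^sub>2]) = 0}"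

definition lower_semicontinuous_on ::
  "'b::topological_space set \<Rightarrow> ('b \<Rightarrow> 'c::linorder) \<Rightarrow> bool" where
  "lower_semicontinuous_on S f \<longleftrightarrow>
     (\<forall>x\<in>S. \<forall>y<f x. eventually (\<lambda>z. y < f z) (at x within S))"

end

theory Submission
  imports Defs
begin

text \<open>Stopping at time \<open>0\<close> gives \<open>V \<ge> G\<close>, and continuity of \<open>V\<close> makes \<open>{H > 0}\<close> relatively open.
  If \<open>H\<close> is positive at \<open>(a, b)\<close>, it is still positive at some \<open>(a, t)\<close> with \<open>t > b\<close>, and
  monotonicity pushes every zero of \<open>H(a, \<cdot>)\<close> beyond \<open>t\<close>; so \<open>b\<close> lies strictly below the boundary.
  Lower semicontinuity is openness of \<open>{H > 0}\<close> in the first coordinate.\<close>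

lemma gain_nonneg: "x \<in> quadrant \<Longrightarrow> 0 \<le> gain \<alpha> x"
  by (auto simp: quadrant_def gain_def)

lemma continuous_on_gain: "continuous_on S (gain \<alpha>)"
  unfolding gain_def by (intro continuous_intros)

text \<open>The running cost is integrated over the single instant 0, a Lebesgue null set, so only
  the gain at the starting point survives.\<close>

lemma payoff_zero:
  "payoff r \<alpha> c Y (\<lambda>_. 0) \<omega> = ereal (gain \<alpha> (Y 0 \<omega>))"
proof -
  have "{s::real. 0 \<le> s \<and> ennreal s \<le> 0} = {0}"
    by auto
  moreover have "(\<integral>\<^sup>+ s\<in>{0}. f s \<partial>lborel) = 0" for f :: "real \<Rightarrow> ennreal"
    by (intro nn_integral_null_set countable_imp_null_set_lborel) simp
  ultimately show ?thesis
    by (simp add: payoff_def zero_ennreal.rep_eq)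
qed

lemma (in prob_space) gain_le_value_fun:
  assumes "filtration (space M) F" and "\<forall>\<omega>\<in>space M. X x 0 \<omega> = x" and "x \<in> quadrant"
  shows "ereal (gain \<alpha> x) \<le> value_fun M F r \<alpha> c X x"
proof -
  let ?Z = "payoff r \<alpha> c (X x) (\<lambda>_. 0)"
  have Z: "?Z \<omega> = ereal (gain \<alpha> x)" if "\<omega> \<in> space M" for \<omega>
    using that assms(2) by (simp add: payoff_zero)
  have pos: "(\<integral>\<^sup>+ \<omega>. e2ennreal (?Z \<omega>) \<partial>M) = ennreal (gain \<alpha> x)"
    by (simp add: Z emeasure_space_1 e2ennreal_ereal cong: nn_integral_cong)
  \<comment> \<open>\<open>e2ennreal\<close> truncates at zero, so a nonnegative gain contributes
    only to the positive part.\<close>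
  have neg: "(\<integral>\<^sup>+ \<omega>. e2ennreal (- ?Z \<omega>) \<partial>M) = 0"
    using gain_nonneg[OF assms(3)]
    by (simp add: Z e2ennreal_ereal ennreal_neg cong: nn_integral_cong)
  \<comment> \<open>The supremum in \<open>value_fun\<close> ranges only over times whose payoff has
    an expectation; here the positive part has a finite integral, which admits the time 0.\<close>
  have "has_expectation M ?Z"
    by (simp add: has_expectation_def pos)
  moreover have "stopping_time F (\<lambda>_. 0)"
    by (rule stopping_timeI) simp
  ultimately have "ext_expectation M ?Z \<le> value_fun M F r \<alpha> c X x"
    unfolding value_fun_def by (intro SUP_upper) simp
  moreover have "ext_expectation M ?Z = ereal (gain \<alpha> x)"
    using gain_nonneg[OF assms(3)] by (simp add: ext_expectation_def pos neg enn2ereal_ennreal zero_ennreal.rep_eq)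
  ultimately show ?thesis
    by simp
qed

text \<open>\<open>V\<close> takes values in \<open>ereal\<close>, so instead of subtracting limits
  a level \<open>m\<close> is put strictly between the gain and \<open>V\<close> at
  \<open>x\<close>. Near \<open>x\<close> the gain stays below \<open>m\<close> and \<open>V\<close>
  above it, also when \<open>V x\<close> is infinite.\<close>

lemma eventually_excess_pos:
  assumes "continuous_on quadrant V" and "x \<in> quadrant" and "0 < excess \<alpha> V x"
  shows "\<forall>\<^sub>F y in at x within quadrant. 0 < excess \<alpha> V y"
proof -
  have "ereal (gain \<alpha> x) < V x"
    using assms(3) by (cases "V x") (auto simp: excess_def)
  then obtain m where m: "ereal (gain \<alpha> x) < m" "m < V x"
    using dense by blast
  have "((\<lambda>y. ereal (gain \<alpha> y)) \<longlongrightarrow> ereal (gain \<alpha> x)) (at x within quadrant)"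
    using continuous_on_gain[of quadrant \<alpha>] assms(2) by (auto simp: continuous_on_def)
  from order_tendstoD(2)[OF this m(1)]
  have "\<forall>\<^sub>F y in at x within quadrant. ereal (gain \<alpha> y) < m" .
  moreover have "\<forall>\<^sub>F y in at x within quadrant. m < V y"
    using assms(1,2) m(2) by (auto simp: continuous_on_def intro: order_tendstoD(1))
  ultimately show ?thesis
  proof eventually_elim
    case (elim y)
    then have "ereal (gain \<alpha> y) < V y" by (rule less_trans)
    then show ?case
      by (cases "V y") (auto simp: excess_def)
  qed
qed

lemma vector_2_eta: "vector [x $ 1, x $ 2] = (x :: 'a::zero ^ 2)"
  by (simp add: vec_eq_iff forall_2)

lemma vector_in_quadrant: "vector [a, b] \<in> quadrant \<longleftrightarrow> 0 \<le> a \<and> 0 \<le> b"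
  by (simp add: quadrant_def)

lemma tendsto_vector_2:
  fixes f g :: "'b \<Rightarrow> real"
  assumes "(f \<longlongrightarrow> a) A" and "(g \<longlongrightarrow> b) A"
  shows "((\<lambda>t. vector [f t, g t] :: real^2) \<longlongrightarrow> vector [a, b]) A"
proof (rule vec_tendstoI)
  fix i :: 2
  show "((\<lambda>t. vector [f t, g t] $ i) \<longlongrightarrow> vector [a, b] $ i) A"
    using exhaust_2[of i] assms by auto
qed

text \<open>Restricts a local property in the quadrant to a curve through the point. It is applied
  to the vertical line, for strictness below the boundary, and to the horizontal line, for lower
  semicontinuity.\<close>

lemma eventually_quadrant_curve:
  fixes f g :: "real \<Rightarrow> real"
  assumes ev: "\<forall>\<^sub>F y in at (vector [f t, g t]) within quadrant. P y"
    and at: "P (vector [f t, g t])"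
    and lim: "(f \<longlongrightarrow> f t) (at t within S)" "(g \<longlongrightarrow> g t) (at t within S)"
    and nonneg: "\<forall>s\<in>S. 0 \<le> f s \<and> 0 \<le> g s"
  shows "\<forall>\<^sub>F s in at t within S. P (vector [f s, g s])"
proof -
  \<comment> \<open>Including the base point replaces the punctured filter by \<open>nhds\<close>,
    so a limit along the curve can be composed with it even if the curve returns to that
    point.\<close>
  have "\<forall>\<^sub>F y in nhds (vector [f t, g t]). y \<in> quadrant \<longrightarrow> P y"
    using ev at by (auto simp: eventually_at_filter elim: eventually_mono)
  from eventually_compose_filterlim[OF this tendsto_vector_2[OF lim]]
  have "\<forall>\<^sub>F s in at t within S. vector [f s, g s] \<in> quadrant \<longrightarrow> P (vector [f s, g s])" .
  moreover have "\<forall>\<^sub>F s in at t within S. s \<in> S"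
    by (simp add: eventually_at_filter)
  ultimately show ?thesis
    by eventually_elim (use nonneg in \<open>auto simp: vector_in_quadrant\<close>)
qed

lemma excess_pos_iff_less_boundary:
  assumes cont: "continuous_on quadrant V"
    and nonneg: "\<forall>x\<in>quadrant. 0 \<le> excess \<alpha> V x"
    and anti: "antimono_on {0..} (\<lambda>b. excess \<alpha> V (vector [a, b]))"
    and ab: "0 \<le> a" "0 \<le> b"
  shows "0 < excess \<alpha> V (vector [a, b]) \<longleftrightarrow> ennreal b < boundary (excess \<alpha> V) a"
proof
  assume pos: "0 < excess \<alpha> V (vector [a, b])"
  have ev: "\<forall>\<^sub>F t in at b within {0..}. 0 < excess \<alpha> V (vector [a, t])"
    by (rule eventually_quadrant_curve[where f = "\<lambda>_. a" and g = "\<lambda>t. t"])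
      (use eventually_excess_pos[OF cont _ pos] ab pos in \<open>auto simp: vector_in_quadrant\<close>)
  \<comment> \<open>Approaching \<open>b\<close> from the right stays in \<open>{0..}\<close> even
    when \<open>b = 0\<close>, and yields a \<open>t\<close> strictly above
    \<open>b\<close>.\<close>
  have "at_right b \<le> at b within {0..}"
    using ab by (intro at_le) auto
  from filter_leD[OF this ev]
  have "\<forall>\<^sub>F t in at_right b. 0 < excess \<alpha> V (vector [a, t])" .
  moreover have "\<forall>\<^sub>F t in at_right b. b < t"
    by (rule eventually_at_right_less)
  ultimately have "\<forall>\<^sub>F t in at_right b. b < t \<and> 0 < excess \<alpha> V (vector [a, t])"
    by eventually_elim simp
  then obtain t where t: "b < t" "0 < excess \<alpha> V (vector [a, t])"
    using eventually_happens trivial_limit_at_right_real by blast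
  \<comment> \<open>If there is no zero on this vertical line, the infimum is \<open>top\<close> and
    the bound holds vacuously.\<close>
  have "ennreal t \<le> boundary (excess \<alpha> V) a"
    unfolding boundary_def
  proof (rule Inf_greatest, clarify)
    fix s assume s: "0 \<le> s" "excess \<alpha> V (vector [a, s]) = 0"
    have "t \<le> s"
    proof (rule ccontr)
      assume "\<not> t \<le> s"
      with s(1) have "excess \<alpha> V (vector [a, t]) \<le> excess \<alpha> V (vector [a, s])"
        by (intro monotone_onD[OF anti]) auto
      with s t show False by simp
    qed
    then show "ennreal t \<le> ennreal s"
      by (rule ennreal_leI)
  qed
  moreover have "ennreal b < ennreal t"
    using t(1) ab by (simp add: ennreal_less_iff)
  ultimately show "ennreal b < boundary (excess \<alpha> V) a"
    by simp
next
  assume less: "ennreal b < boundary (excess \<alpha> V) a"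
  \<comment> \<open>A zero at \<open>b\<close> would belong to the set whose infimum is the
    boundary, forcing the boundary down to at most \<open>b\<close>.\<close>
  have "excess \<alpha> V (vector [a, b]) \<noteq> 0"
  proof
    assume "excess \<alpha> V (vector [a, b]) = 0"
    with ab(2) have "boundary (excess \<alpha> V) a \<le> ennreal b"
      unfolding boundary_def by (intro Inf_lower) blast
    with less show False by simp
  qed
  moreover have "0 \<le> excess \<alpha> V (vector [a, b])"
    using nonneg ab by (simp add: vector_in_quadrant)
  ultimately show "0 < excess \<alpha> V (vector [a, b])"
    by simp
qed

theorem theorem6p2:
  fixes M :: "'a measure" and F :: "ennreal \<Rightarrow> 'a measure"
    and W :: "real \<Rightarrow> 'a \<Rightarrow> real^2"
    and \<beta> :: "real^2 \<Rightarrow> real^2" and \<sigma> :: "real^2 \<Rightarrow> real^2^2"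
    and \<theta>\<^sub>1 \<theta>\<^sub>2 r \<alpha> :: real and c :: "real^2 \<Rightarrow> real"
    and X L :: "real^2 \<Rightarrow> real \<Rightarrow> 'a \<Rightarrow> real^2"
    and V H :: "real^2 \<Rightarrow> ereal"
  assumes "usual_conditions M F" and "brownian_motion M F W"
    and "condition_D M F W \<beta> \<sigma> \<theta>\<^sub>1 \<theta>\<^sub>2 X L"
    and "r > 0" and "\<alpha> > 0"
    and "continuous_on quadrant c" and "\<forall>x\<in>quadrant. c x \<ge> 0"
    and "V = value_fun M F r \<alpha> c X" and "H = excess \<alpha> V"
    and "continuous_on quadrant V"
    and "\<forall>x\<^sub>1\<ge>0. antimono_on {0..} (\<lambda>x\<^sub>2. H (vector [x\<^sub>1, x\<^sub>2]))"
  shows "lower_semicontinuous_on {0..} (boundary H) \<and>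
         stopping_region H =
           {x. 0 \<le> x $ 1 \<and> 0 \<le> x $ 2 \<and> ennreal (x $ 2) \<ge> boundary H (x $ 1)} \<and>
         continuation_region H =
           {x. 0 \<le> x $ 1 \<and> 0 \<le> x $ 2 \<and> ennreal (x $ 2) < boundary H (x $ 1)}"
proof (intro conjI)
  from assms(1) interpret prob_space M
    by (simp add: usual_conditions_def)
  have filt: "filtration (space M) F"
    using assms(1) by (simp add: usual_conditions_def)
  have start: "\<forall>\<omega>\<in>space M. X x 0 \<omega> = x" if "x \<in> quadrant" for x
    using assms(3) that
    by (simp add: condition_D_def unique_strong_solution_def reflected_sde_solution_def)
  have nonneg: "\<forall>x\<in>quadrant. 0 \<le> excess \<alpha> V x"
    using gain_le_value_fun[OF filt, of X] start \<open>V = _\<close>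
    by (simp add: excess_def ereal_diff_positive)
  have iff: "0 < H (vector [a, b]) \<longleftrightarrow> ennreal b < boundary H a"
    if "0 \<le> a" "0 \<le> b" for a b
    unfolding \<open>H = _\<close>
    by (rule excess_pos_iff_less_boundary) (use assms nonneg that in auto)
  have pos_iff: "0 < H x \<longleftrightarrow> ennreal (x $ 2) < boundary H (x $ 1)" if "x \<in> quadrant" for x
    using iff[of "x $ 1" "x $ 2"] that by (simp add: vector_2_eta quadrant_def)
  \<comment> \<open>Since \<open>H\<close> is nonnegative on the quadrant, its zeros are exactly the
    points where it is not positive. This puts the boundary points themselves, where the boundary is
    finite, into the stopping region.\<close>
  have zero_iff: "H x = 0 \<longleftrightarrow> boundary H (x $ 1) \<le> ennreal (x $ 2)" if "x \<in> quadrant" for x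
    using pos_iff[OF that] nonneg that \<open>H = _\<close> by (metis not_less order.order_iff_strict)
  show "stopping_region H =
      {x. 0 \<le> x $ 1 \<and> 0 \<le> x $ 2 \<and> ennreal (x $ 2) \<ge> boundary H (x $ 1)}"
    using zero_iff by (auto simp: stopping_region_def quadrant_def)
  show "continuation_region H =
      {x. 0 \<le> x $ 1 \<and> 0 \<le> x $ 2 \<and> ennreal (x $ 2) < boundary H (x $ 1)}"
    using pos_iff by (auto simp: continuation_region_def quadrant_def)
  show "lower_semicontinuous_on {0..} (boundary H)"
    unfolding lower_semicontinuous_on_def
  proof (intro ballI allI impI)
    fix a :: real and y
    assume a: "a \<in> {0..}" and y: "y < boundary H a"
    \<comment> \<open>A level strictly below the boundary is finite, hence a real \<open>b\<close>,
      so the test level becomes a point \<open>(a, b)\<close> of the continuation region.\<close>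
    then have "y < top"
      using less_le_trans top_greatest by blast
    then obtain b where b: "0 \<le> b" "y = ennreal b"
      by (cases y) auto
    have pos: "0 < H (vector [a, b])"
      using iff a b y by simp
    \<comment> \<open>Moving horizontally at the fixed height \<open>b\<close> keeps
      \<open>H\<close> positive, and \<open>iff\<close> turns this back into a bound on the boundary
      at nearby \<open>t\<close>.\<close>
    have "\<forall>\<^sub>F t in at a within {0..}. 0 < H (vector [t, b])"
      by (rule eventually_quadrant_curve[where f = "\<lambda>t. t" and g = "\<lambda>_. b"])
        (use eventually_excess_pos[OF assms(10), of "vector [a, b]" \<alpha>] a b pos \<open>H = _\<close>
          in \<open>auto simp: vector_in_quadrant\<close>)
    moreover have "\<forall>\<^sub>F t in at a within {0..}. t \<in> {0..}"
      by (simp add: eventually_at_filter)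
    ultimately show "\<forall>\<^sub>F t in at a within {0..}. y < boundary H t"
      by eventually_elim (use iff b in auto)
  qed
qed

end
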